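(* Let $n$ be a composite number and let $U_n = \frac{2}{n}J_n - I_n$. Then $U_n$ is a global unitary operator: for every factorization $n = pq$ with integers $p,q\ge 2$, there do not exist unitary matrices $u_1$ of order $p$ and $u_2$ of order $q$ with $U_n = u_1\otimes u_2$.
   Context: $J_n$ denotes the $n\times n$ all-ones matrix and $I_n$ the $n\times n$ identity matrix; $U_n$ is unitary. A unitary operator on $\mathbb{C}^p\otimes\mathbb{C}^q$ is local if it equals $u_1\otimes u_2$ for unitaries $u_1,u_2$ acting on the factors ($\otimes$ the Kronecker/tensor product), and global otherwise. *)

theory Defs
  imports
    "HOL-Computational_Algebra.Primes"
    "Jordan_Normal_Form.Schur_Decomposition"
begin

definition unitary_mat :: "nat \<Rightarrow> complex mat \<Rightarrow> bool" where
  "unitary_mat n A \<longleftrightarrow>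
     A \<in> carrier_mat n n \<and> mat_adjoint A * A = 1\<^sub>m n \<and> A * mat_adjoint A = 1\<^sub>m n"

(* Indices start at 0, so entry (i, j) lies in block (i div dim_row B, j div dim_col B). *)
definition kronecker :: "complex mat \<Rightarrow> complex mat \<Rightarrow> complex mat" (infixl "\<otimes>\<^sub>K" 70) where
  "A \<otimes>\<^sub>K B = mat (dim_row A * dim_row B) (dim_col A * dim_col B)
     (\<lambda>(i, j). A $$ (i div dim_row B, j div dim_col B) * B $$ (i mod dim_row B, j mod dim_col B))"

(* C^p (x) C^q is identified with C^(p*q) by the ordering of the basis that the Kronecker
   product uses. *)
definition local_unitary :: "nat \<Rightarrow> nat \<Rightarrow> complex mat \<Rightarrow> bool" where
  "local_unitary p q U \<longleftrightarrow>
     (\<exists>u1 u2. unitary_mat p u1 \<and> unitary_mat q u2 \<and> U = u1 \<otimes>\<^sub>K u2)"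

definition global_unitary :: "nat \<Rightarrow> nat \<Rightarrow> complex mat \<Rightarrow> bool" where
  "global_unitary p q U \<longleftrightarrow> unitary_mat (p * q) U \<and> \<not> local_unitary p q U"

definition all_ones_mat :: "nat \<Rightarrow> complex mat" where
  "all_ones_mat n = mat n n (\<lambda>_. 1)"

definition U_mat :: "nat \<Rightarrow> complex mat" where
  "U_mat n = (2 / of_nat n) \<cdot>\<^sub>m all_ones_mat n - 1\<^sub>m n"

end

theory Submission
  imports Defs
begin

text \<open>
  The matrix is a real reflection: it is symmetric and squares to the identity. In a Kronecker
  product, the \<open>2 \<times> 2\<close> array of the entries of the first row in columns
  \<open>0, 1, q, q + 1\<close> has rank one, whereas with \<open>c = 2 / n\<close> these entries of the
  reflection are \<open>c - 1, c, c, c\<close>, of determinant \<open>-c \<noteq> 0\<close>.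
\<close>

lemma U_mat_carrier [simp]: "U_mat n \<in> carrier_mat n n"
  by (simp add: U_mat_def all_ones_mat_def minus_carrier_mat)

lemma dim_U_mat [simp]: "dim_row (U_mat n) = n" "dim_col (U_mat n) = n"
  using carrier_matD[OF U_mat_carrier] by blast+

lemma U_mat_index:
  "i < n \<Longrightarrow> j < n \<Longrightarrow> U_mat n $$ (i, j) = 2 / of_nat n - (if i = j then 1 else 0)"
  by (simp add: U_mat_def all_ones_mat_def)

lemma mat_adjoint_U_mat: "mat_adjoint (U_mat n) = U_mat n"
  by (rule eq_matI) (auto simp: mat_adjoint_def mat_of_rows_index U_mat_index)

text \<open>With J the all-ones matrix, J * J = n J, so in the square of c J - I the coefficient of
  J is n c^2 - 2 c, which vanishes for c = 2 / n.\<close>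

lemma U_mat_square:
  assumes "n > 0"
  shows "U_mat n * U_mat n = 1\<^sub>m n"
proof (rule eq_matI)
  fix i j assume "i < dim_row (1\<^sub>m n :: complex mat)" "j < dim_col (1\<^sub>m n :: complex mat)"
  then have ij: "i < n" "j < n" by simp_all
  define c :: complex where "c = 2 / of_nat n"
  have "(U_mat n * U_mat n) $$ (i, j) = (\<Sum>k<n. U_mat n $$ (i, k) * U_mat n $$ (k, j))"
    using ij by (auto simp: scalar_prod_def lessThan_atLeast0)
  also have "\<dots> = (\<Sum>k<n. (c - (if i = k then 1 else 0)) * (c - (if k = j then 1 else 0)))"
    using ij by (intro sum.cong) (auto simp: U_mat_index c_def)
  \<comment> \<open>The product of the two indicators is rewritten so that k occurs in only one
    condition; each term then sums as a single delta.\<close>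
  also have "\<dots> = (\<Sum>k<n. c * c - (if k = j then c else 0) - (if i = k then c else 0)
      + (if i = k then if i = j then 1 else 0 else 0))"
    by (intro sum.cong) (auto simp: algebra_simps)
  also have "\<dots> = of_nat n * (c * c) - c - c + (if i = j then 1 else 0)"
    using ij by (simp add: sum.distrib sum_subtractf)
  also have "\<dots> = (1\<^sub>m n) $$ (i, j)"
    using ij assms by (simp add: c_def)
  finally show "(U_mat n * U_mat n) $$ (i, j) = (1\<^sub>m n) $$ (i, j)" .
qed simp_all

lemma unitary_U_mat: "n > 0 \<Longrightarrow> unitary_mat n (U_mat n)"
  by (simp add: unitary_mat_def mat_adjoint_U_mat U_mat_square)

lemma U_mat_neq_kronecker:
  assumes "p \<ge> 2" "q \<ge> 2" "A \<in> carrier_mat p p" "B \<in> carrier_mat q q"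
  shows "U_mat (p * q) \<noteq> A \<otimes>\<^sub>K B"
proof
  assume eq: "U_mat (p * q) = A \<otimes>\<^sub>K B"
  define c :: complex where "c = 2 / of_nat (p * q)"
  \<comment> \<open>All four columns exist: the largest satisfies q + 1 < 2 q \<le> p q, as q \<ge>
    2.\<close>
  have "2 * q \<le> p * q" using assms by simp
  then have less: "0 < p * q" "1 < p * q" "q < p * q" "q + 1 < p * q"
    using assms(2) by linarith+
  have K: "(A \<otimes>\<^sub>K B) $$ (0, j) = A $$ (0, j div q) * B $$ (0, j mod q)" if "j < p * q" for j
    using assms less(1) that by (auto simp: kronecker_def)
  have U: "U_mat (p * q) $$ (0, j) = c - (if j = 0 then 1 else 0)" if "j < p * q" for j
    using less(1) that by (auto simp: U_mat_index c_def)
  have row: "A $$ (0, j div q) * B $$ (0, j mod q) = c - (if j = 0 then 1 else 0)"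
    if "j < p * q" for j
    using K[OF that] U[OF that] eq by simp
  \<comment> \<open>Under div and mod q, the columns 0, 1, q, q + 1 become the four pairs over {0,
    1}.\<close>
  have "(q + 1) div q = 1" "(q + 1) mod q = 1"
    using assms(2) by (simp_all add: div_nat_eqI mod_Suc)
  then have e: "A $$ (0, 0) * B $$ (0, 0) = c - 1" "A $$ (0, 0) * B $$ (0, 1) = c"
    "A $$ (0, 1) * B $$ (0, 0) = c" "A $$ (0, 1) * B $$ (0, 1) = c"
    using row[OF less(1)] row[OF less(2)] row[OF less(3)] row[OF less(4)] assms(2) by auto
  \<comment> \<open>Both sides are the product of the same four entries of \<open>A\<close> and
    \<open>B\<close>, paired differently.\<close>
  have "(c - 1) * c = c * c"
    using e by (metis mult.assoc mult.left_commute)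
  then have "c = 0" by (simp add: algebra_simps)
  then show False using less(1) by (simp add: c_def)
qed

theorem theorem4:
  fixes n :: nat
  assumes "n > 1" and "\<not> prime n"
  shows "unitary_mat n (U_mat n) \<and>
    (\<forall>p q :: nat. p \<ge> 2 \<longrightarrow> q \<ge> 2 \<longrightarrow> n = p * q \<longrightarrow> global_unitary p q (U_mat n))"
  using assms(1) unitary_U_mat[of n] U_mat_neq_kronecker
  unfolding global_unitary_def local_unitary_def
  by (auto simp: unitary_mat_def)

end
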